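(* There exist a finite GCD closed set $S=\{x_1,\ldots,x_n\}$ of distinct odd positive integers and a real number $\alpha_0>1$ such that the $n\times n$ power LCM matrix whose $(i,j)$-entry is $\mathrm{lcm}(x_i,x_j)^{\alpha_0}$ is singular.
   Context: A finite set $S$ of positive integers is GCD closed if $\gcd(a,b)\in S$ for all $a,b\in S$. *)

theory Defs
  imports Complex_Main "Jordan_Normal_Form.Matrix"
begin

definition gcd_closed :: "nat set \<Rightarrow> bool" where
  "gcd_closed S \<longleftrightarrow> (\<forall>a\<in>S. \<forall>b\<in>S. gcd a b \<in> S)"

definition power_lcm_mat :: "nat \<Rightarrow> (nat \<Rightarrow> nat) \<Rightarrow> real \<Rightarrow> real mat" where
  "power_lcm_mat n x \<alpha> = mat n n (\<lambda>(i, j). real (lcm (x i) (x j)) powr \<alpha>)"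

end

(* Write lcm(a,b)^t = a^t b^t gcd(a,b)^(-t).  A vector of the form c_j x_j^(-t) is then in the
   kernel of the power LCM matrix as soon as sum_j c_j gcd(x_i,x_j)^(-t) = 0 for every i.  If
   c_j is the Moebius function mu(x_j, m) of a GCD closed set with largest element m (for
   divisibility), all these equations hold identically in t, except the one for m, which reads
   sum_j mu(x_j, m) x_j^(-t) = 0.  We choose the set so that mu(1, m) = -1, which makes the
   left-hand side negative for large t, while sufficiently many elements above 3 give 3 the
   coefficient 3, which makes it positive at t = 1. *)
theory Submission
  imports Defs
begin

lemma singular_if_kernel_vector:
  fixes A :: "'a::comm_ring_1 mat"
  assumes A: "A \<in> carrier_mat n n" and v: "v \<in> carrier_vec n"
    and "A *\<^sub>v v = 0\<^sub>v n" and "v \<noteq> 0\<^sub>v n"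
  shows "\<not> invertible_mat A"
proof
  assume "invertible_mat A"
  then obtain B where AB: "A * B = 1\<^sub>m n" and BA: "B * A = 1\<^sub>m (dim_row B)"
    using A by (auto simp: invertible_mat_def inverts_mat_def)
  \<comment> \<open>\<open>invertible_mat\<close> leaves the dimensions of the inverse open; they
    are read off the two product equations.\<close>
  have "dim_col B = n" using AB by (metis index_mult_mat(3) index_one_mat(3))
  moreover have "dim_row B = n" using BA A
    by (metis carrier_matD(2) index_mult_mat(3) index_one_mat(3))
  ultimately have B: "B \<in> carrier_mat n n" by auto
  have "v = (B * A) *\<^sub>v v" using BA B v by simp
  also have "\<dots> = B *\<^sub>v (A *\<^sub>v v)" using A B v by simp
  also have "\<dots> = 0\<^sub>v n" using assms(3) B by auto
  finally show False using assms(4) by simp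
qed

lemma lcm_powr:
  fixes a b :: nat
  assumes "0 < a" "0 < b"
  shows "real (lcm a b) powr t = real a powr t * real b powr t * real (gcd a b) powr (- t)"
proof -
  have "real (lcm a b) powr t * real (gcd a b) powr t = real (lcm a b * gcd a b) powr t"
    by (simp only: of_nat_mult powr_mult of_nat_0_le_iff)
  also have "lcm a b * gcd a b = a * b" by simp
  also have "real (a * b) powr t = real a powr t * real b powr t" by (simp add: powr_mult)
  finally have "real (lcm a b) powr t * real (gcd a b) powr t = real a powr t * real b powr t" .
  moreover have "real (gcd a b) powr t > 0" using assms by simp
  ultimately show ?thesis by (simp add: powr_minus field_simps)
qed

lemma power_lcm_mat_singular:
  fixes x :: "nat \<Rightarrow> nat" and c :: "nat \<Rightarrow> real"
  assumes pos: "\<And>i. i < n \<Longrightarrow> 0 < x i"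
    and ker: "\<And>i. i < n \<Longrightarrow> (\<Sum>j<n. c j * real (gcd (x i) (x j)) powr (- t)) = 0"
    and k: "k < n" "c k \<noteq> 0"
  shows "\<not> invertible_mat (power_lcm_mat n x t)"
proof (rule singular_if_kernel_vector)
  let ?v = "vec n (\<lambda>j. c j * real (x j) powr (- t))"
  show "power_lcm_mat n x t \<in> carrier_mat n n" by (simp add: power_lcm_mat_def)
  show "?v \<in> carrier_vec n" by simp
  show "?v \<noteq> 0\<^sub>v n"
  proof
    assume "?v = 0\<^sub>v n"
    then have "?v $ k = 0\<^sub>v n $ k" by simp
    then show False using k pos[of k] by simp
  qed
  show "power_lcm_mat n x t *\<^sub>v ?v = 0\<^sub>v n"
  proof (rule eq_vecI)
    fix i assume "i < dim_vec (0\<^sub>v n :: real vec)"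
    then have i: "i < n" by simp
    have "(power_lcm_mat n x t *\<^sub>v ?v) $ i =
        (\<Sum>j<n. real (lcm (x i) (x j)) powr t * (c j * real (x j) powr (- t)))"
      using i by (simp add: power_lcm_mat_def scalar_prod_def lessThan_atLeast0)
    \<comment> \<open>The weight \<open>x j powr (- t)\<close> cancels the factor
      \<open>x j powr t\<close> of the lcm, and what remains in front does not depend on
      \<open>j\<close>.\<close>
    also have "\<dots> = (\<Sum>j<n. real (x i) powr t * (c j * real (gcd (x i) (x j)) powr (- t)))"
    proof (rule sum.cong)
      fix j assume "j \<in> {..<n}"
      then have "0 < x i" "0 < x j" using pos i by auto
      then show "real (lcm (x i) (x j)) powr t * (c j * real (x j) powr (- t)) =
          real (x i) powr t * (c j * real (gcd (x i) (x j)) powr (- t))"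
        by (simp add: lcm_powr powr_minus field_simps)
    qed simp
    also have "\<dots> = 0" using ker[OF i] by (simp flip: sum_distrib_left)
    finally show "(power_lcm_mat n x t *\<^sub>v ?v) $ i = 0\<^sub>v n $ i" using i by simp
  qed (simp add: power_lcm_mat_def)
qed

text \<open>The primes 3, 5, 7 with their pairwise products, closed off by 15015 = 3*5*7*11*13. The
  elements 33 and 39 raise the Moebius value at 3 from 1 to 3.\<close>

definition odd_list :: "nat list" where
  "odd_list = [1, 3, 5, 7, 15, 21, 35, 33, 39, 15015]"

text \<open>The values \<open>\<mu>(y, 15015)\<close> of the Moebius function of the set ordered by divisibility.\<close>

definition moebius_list :: "real list" where
  "moebius_list = [-1, 3, 1, 1, -1, -1, -1, -1, -1, 1]"

lemma sum_lessThan_10: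
  "(\<Sum>j<10. h j) = h 0 + h 1 + h 2 + h 3 + h 4 + h 5 + h 6 + h 7 + h 8 + h 9"
  for h :: "nat \<Rightarrow> 'a::comm_monoid_add"
  by (simp add: numeral_eq_Suc ac_simps)

lemma odd_list_gcd_closed: "gcd_closed (set odd_list)"
  by (simp add: gcd_closed_def odd_list_def gcd_non_0_nat)

text \<open>An instance of Weisner's theorem: for a fixed element a below the top, the Moebius
  values of all y with gcd(a,y) = d add up to 0. So every g(d) gets coefficient 0, and
  \<open>g\<close> can be arbitrary.\<close>

lemma moebius_list_orthogonal:
  fixes g :: "nat \<Rightarrow> real"
  assumes "i < 9"
  shows "(\<Sum>j<10. moebius_list ! j * g (gcd (odd_list ! i) (odd_list ! j))) = 0"
proof -
  have "i \<in> {0,1,2,3,4,5,6,7,8}" using assms by auto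
  then show ?thesis
    by (auto simp: sum_lessThan_10 moebius_list_def odd_list_def gcd_non_0_nat)
qed

lemma moebius_list_root:
  "\<exists>t>1. (\<Sum>j<10. moebius_list ! j * real (odd_list ! j) powr (- t)) = 0"
proof -
  define f :: "real \<Rightarrow> real"
    where "f t = (\<Sum>j<10. moebius_list ! j * real (odd_list ! j) powr (- t))" for t
  have f: "f t = - 1 + 3 * 3 powr (- t) + 5 powr (- t) + 7 powr (- t) - 15 powr (- t)
      - 21 powr (- t) - 35 powr (- t) - 33 powr (- t) - 39 powr (- t) + 15015 powr (- t)" for t
    by (simp add: f_def sum_lessThan_10 moebius_list_def odd_list_def)
  \<comment> \<open>At 1 the term for 3 cancels the -1, and 1/5 + 1/7 outweighs the negative
    reciprocals; at 2 the -1 dominates.\<close>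
  have f1: "0 < f 1" by (simp add: f powr_minus)
  have f2: "f 2 < 0" by (simp add: f powr_minus)
  have "continuous_on {1..2} f" unfolding f by (intro continuous_intros) auto
  then obtain t where t: "1 \<le> t" "f t = 0"
    using IVT2'[of f 2 0 1] f1 f2 by auto
  then have "1 < t" using f1 by (cases "t = 1") auto
  then show ?thesis using t(2) by (auto simp: f_def)
qed

theorem mainTheorem6:
  shows "\<exists>(S :: nat set) (n :: nat) (x :: nat \<Rightarrow> nat) (\<alpha>\<^sub>0 :: real).
    finite S \<and> gcd_closed S \<and> (\<forall>a\<in>S. 0 < a \<and> odd a) \<and>
    bij_betw x {..<n} S \<and>
    \<alpha>\<^sub>0 > 1 \<and>
    \<not> invertible_mat (power_lcm_mat n x \<alpha>\<^sub>0)"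
proof -
  obtain t where t: "t > 1"
    and root: "(\<Sum>j<10. moebius_list ! j * real (odd_list ! j) powr (- t)) = 0"
    using moebius_list_root by blast
  have odd: "\<forall>a\<in>set odd_list. 0 < a \<and> odd a" by (simp add: odd_list_def)
  have len: "length odd_list = 10" by (simp add: odd_list_def)
  have bij: "bij_betw (nth odd_list) {..<10} (set odd_list)"
    by (rule bij_betw_nth) (auto simp: odd_list_def)
  have div: "odd_list ! j dvd odd_list ! 9" if "j < 10" for j
  proof -
    have "\<forall>a\<in>set odd_list. a dvd odd_list ! 9" by (simp add: odd_list_def)
    then show ?thesis using that len by simp
  qed
  have "\<not> invertible_mat (power_lcm_mat 10 (nth odd_list) t)"
  \<comment> \<open>Index 9 is the element 15015, whose coefficient is 1.\<close>
  proof (rule power_lcm_mat_singular[where c = "nth moebius_list" and k = 9])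
    show "0 < odd_list ! i" if "i < 10" for i using odd len that by simp
    show "(\<Sum>j<10. moebius_list ! j * real (gcd (odd_list ! i) (odd_list ! j)) powr (- t)) = 0"
      if "i < 10" for i
    proof (cases "i = 9")
      case True
      \<comment> \<open>All elements divide 15015, so the gcds in this row are the elements
        themselves and the equation is the choice of \<open>t\<close>.\<close>
      then show ?thesis using root div by (simp add: gcd_nat.absorb2)
    next
      case False
      then show ?thesis
        using that by (intro moebius_list_orthogonal[of i "\<lambda>d. real d powr (- t)"]) simp
    qed
  qed (simp_all add: moebius_list_def)
  then show ?thesis using odd_list_gcd_closed odd bij t by blast
qed

end
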